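(* Let $k\ge 1$ be an integer and let $G$ be an edge-colored complete graph of order $n$. If $\delta^c(G)\geq \frac{n+k}{2}$, then every vertex of $G$ is contained in at least $k$ rainbow triangles.
   Context: Graphs are finite and simple. An edge-coloring of $G$ is a map $c:E(G)\to\mathbb{N}$; adjacent edges may receive the same color. The color-degree $d^c_G(v)$ of a vertex $v$ is the number of distinct colors on edges incident to $v$, and $\delta^c(G)=\min_{v\in V(G)} d^c_G(v)$ is the minimum color-degree. A subgraph is rainbow if all its edges have pairwise distinct colors; a rainbow triangle is a triangle whose three edges have three distinct colors. Distinct triangles are counted as distinct vertex sets. *)

theory Defs
  imports Complex_Main
begin

text \<open>A graph is given by its vertex set and its set of edges, where an edge is a two-element set of
  vertices. An edge-coloring is a function on sets of vertices of which only the values on the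
  edges are ever used.\<close>

definition pairs :: "'a set \<Rightarrow> 'a set set" where
  "pairs X = {e. e \<subseteq> X \<and> card e = 2}"

definition simple_graph :: "'a set \<Rightarrow> 'a set set \<Rightarrow> bool" where
  "simple_graph V E \<longleftrightarrow> finite V \<and> E \<subseteq> pairs V"

definition complete_graph :: "'a set \<Rightarrow> 'a set set \<Rightarrow> bool" where
  "complete_graph V E \<longleftrightarrow>
     simple_graph V E \<and> (\<forall>u\<in>V. \<forall>v\<in>V. u \<noteq> v \<longrightarrow> {u, v} \<in> E)"

definition color_degree :: "'a set set \<Rightarrow> ('a set \<Rightarrow> nat) \<Rightarrow> 'a \<Rightarrow> nat" where
  "color_degree E c v = card (c ` {e \<in> E. v \<in> e})"

text \<open>Meaningful only for a nonempty vertex set.\<close>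

definition min_color_degree :: "'a set \<Rightarrow> 'a set set \<Rightarrow> ('a set \<Rightarrow> nat) \<Rightarrow> nat" where
  "min_color_degree V E c = Min (color_degree E c ` V)"

definition rainbow :: "('a set \<Rightarrow> nat) \<Rightarrow> 'a set set \<Rightarrow> bool" where
  "rainbow c F \<longleftrightarrow> inj_on c F"

text \<open>Triangles are identified with their vertex sets.\<close>

definition triangle :: "'a set \<Rightarrow> 'a set set \<Rightarrow> 'a set \<Rightarrow> bool" where
  "triangle V E T \<longleftrightarrow> T \<subseteq> V \<and> card T = 3 \<and> pairs T \<subseteq> E"

definition rainbow_triangle ::
    "'a set \<Rightarrow> 'a set set \<Rightarrow> ('a set \<Rightarrow> nat) \<Rightarrow> 'a set \<Rightarrow> bool" where
  "rainbow_triangle V E c T \<longleftrightarrow> triangle V E T \<and> rainbow c (pairs T)"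

end

theory Submission
  imports Defs
begin

text \<open>Fix a vertex \<open>v\<close> and let \<open>S\<close> be the set of those \<open>x\<close> for which the color of \<open>vx\<close> occurs only
  once at \<open>v\<close>. Every other color at \<open>v\<close> occurs at least twice, so the number of the other colors is
  at most \<open>(n - 1 - |S|) / 2\<close>, and the color degree of \<open>v\<close> forces \<open>|S| \<ge> k + 1\<close>. For \<open>x \<in> S\<close> a
  color at \<open>x\<close> is the color of \<open>vx\<close>, or one of these repeated colors, or the color of an edge \<open>xy\<close>
  such that either \<open>vxy\<close> is rainbow or \<open>y \<in> S\<close> and \<open>xy\<close> has the color of \<open>vy\<close>. Edges of the last kind
  are oriented pairs inside \<open>S\<close>, and each pair of vertices of \<open>S\<close> is oriented in at most one way.
  Summing the color degrees over \<open>S\<close> leaves at least \<open>k |S| / 2 \<ge> k\<close> rainbow triangles at \<open>v\<close>.\<close>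

text \<open>Every nonempty fibre of \<open>f\<close> has at least two elements, and the fibres
  partition \<open>A\<close>.\<close>

lemma card_image_two_fibres:
  assumes "finite A" and "\<And>x. x \<in> A \<Longrightarrow> \<exists>y\<in>A. y \<noteq> x \<and> f y = f x"
  shows "2 * card (f ` A) \<le> card A"
proof -
  have "2 \<le> card {x \<in> A. f x = b}" if b: "b \<in> f ` A" for b
  proof -
    from b assms(2) obtain x y where "x \<in> A" "y \<in> A" "y \<noteq> x" "f x = b" "f y = b"
      by (metis imageE)
    then have "card {x, y} \<le> card {x \<in> A. f x = b}"
      using assms(1) by (intro card_mono) auto
    with \<open>y \<noteq> x\<close> show ?thesis by simp
  qed
  then have "(\<Sum>b\<in>f ` A. 2) \<le> (\<Sum>b\<in>f ` A. card {x \<in> A. f x = b})"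
    by (rule sum_mono)
  also have "\<dots> = card A"
    using sum.image_gen[OF assms(1), of "\<lambda>_. 1::nat" f] by simp
  finally show ?thesis by simp
qed

lemma card_le_two_card_image:
  assumes "finite B" and "h ` A \<subseteq> B" and "finite A"
    and "\<And>a. a \<in> A \<Longrightarrow> \<exists>a'. {b \<in> A. h b = h a} \<subseteq> {a, a'}"
  shows "card A \<le> 2 * card B"
proof -
  have "card {x \<in> A. h x = b} \<le> 2" if "b \<in> h ` A" for b
  proof -
    from that obtain a where "a \<in> A" "b = h a" by blast
    with assms(4) obtain a' where "{x \<in> A. h x = b} \<subseteq> {a, a'}" by blast
    then have "card {x \<in> A. h x = b} \<le> card {a, a'}" by (simp add: card_mono)
    also have "\<dots> \<le> 2" by (simp add: card_insert_if)
    finally show ?thesis .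
  qed
  then have "(\<Sum>b\<in>h ` A. card {x \<in> A. h x = b}) \<le> (\<Sum>b\<in>h ` A. 2)"
    by (rule sum_mono)
  moreover have "(\<Sum>b\<in>h ` A. card {x \<in> A. h x = b}) = card A"
    using sum.image_gen[OF assms(3), of "\<lambda>_. 1::nat" h] by simp
  moreover have "card (h ` A) \<le> card B"
    using assms(1,2) by (rule card_mono)
  ultimately show ?thesis by simp
qed

text \<open>Inclusion-exclusion for \<open>A\<close> and its converse, which have equal size, and
  again for \<open>W\<close> and \<open>D\<close>. A pair that occurs in \<open>A\<close> in both
  directions is paid for twice, once by \<open>W\<close> and once by \<open>D\<close>.\<close>

lemma two_card_le_symmetrization:
  assumes "finite W" and "finite D"
    and "A \<union> A\<inverse> \<subseteq> W \<union> D" and "A \<inter> A\<inverse> \<subseteq> W \<inter> D"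
  shows "2 * card A \<le> card W + card D"
proof -
  have fin: "finite A" "finite (A\<inverse>)"
    using assms(1-3) by (meson finite_UnI finite_subset le_sup_iff)+
  have "card A + card (A\<inverse>) = card (A \<union> A\<inverse>) + card (A \<inter> A\<inverse>)"
    using fin by (rule card_Un_Int)
  also have "\<dots> \<le> card (W \<union> D) + card (W \<inter> D)"
    using assms by (intro add_mono card_mono) auto
  also have "\<dots> = card W + card D"
    using assms(1,2) by (rule card_Un_Int[symmetric])
  finally show ?thesis by simp
qed

lemma card_off_diagonal:
  assumes "finite S"
  shows "card {(x, y). x \<in> S \<and> y \<in> S \<and> x \<noteq> y} = card S * (card S - 1)"
proof -
  have "{(x, y). x \<in> S \<and> y \<in> S \<and> x \<noteq> y} = (SIGMA x:S. S - {x})"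
    by auto
  then show ?thesis using assms by simp
qed

lemma color_degree_complete_graph:
  assumes "complete_graph V E" and "v \<in> V"
  shows "color_degree E c v = card ((\<lambda>x. c {v, x}) ` (V - {v}))"
proof -
  have "{e \<in> E. v \<in> e} = (\<lambda>x. {v, x}) ` (V - {v})" (is "?L = ?R")
  proof
    show "?L \<subseteq> ?R"
    proof
      fix e assume e: "e \<in> ?L"
      then have "e \<subseteq> V" "card e = 2" "v \<in> e"
        using assms(1) by (auto simp: complete_graph_def simple_graph_def pairs_def)
      then obtain x where "e = {v, x}" "x \<noteq> v"
        by (auto simp: card_2_iff)
      with \<open>e \<subseteq> V\<close> show "e \<in> ?R" by auto
    qed
    show "?R \<subseteq> ?L"
      using assms by (auto simp: complete_graph_def)
  qed
  then show ?thesis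
    by (simp add: color_degree_def image_image)
qed

lemma pairs_triple:
  assumes "v \<noteq> x" "v \<noteq> y" "x \<noteq> y"
  shows "pairs {v, x, y} = {{v, x}, {v, y}, {x, y}}"
proof
  show "pairs {v, x, y} \<subseteq> {{v, x}, {v, y}, {x, y}}"
    by (auto simp: pairs_def card_2_iff doubleton_eq_iff)
  show "{{v, x}, {v, y}, {x, y}} \<subseteq> pairs {v, x, y}"
    using assms by (auto simp: pairs_def)
qed

lemma rainbow_triangleI:
  assumes "complete_graph V E" and "v \<in> V" "x \<in> V" "y \<in> V"
    and "v \<noteq> x" "v \<noteq> y" "x \<noteq> y"
    and "c {v, x} \<noteq> c {v, y}" "c {x, y} \<noteq> c {v, x}" "c {x, y} \<noteq> c {v, y}"
  shows "rainbow_triangle V E c {v, x, y}"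
  using assms
  by (auto simp: rainbow_triangle_def triangle_def rainbow_def pairs_triple complete_graph_def
      inj_on_def)

text \<open>Removing \<open>v\<close> from a triangle leaves \<open>{x, y}\<close>, which comes only
  from the ordered pairs \<open>(x, y)\<close> and \<open>(y, x)\<close>; hence the factor
  2.\<close>

lemma card_rainbow_triangles_ge:
  assumes "finite V" and "finite W"
    and "\<And>x y. (x, y) \<in> W \<Longrightarrow> x \<noteq> v \<and> y \<noteq> v \<and> rainbow_triangle V E c {v, x, y}"
  shows "card W \<le> 2 * card {T. rainbow_triangle V E c T \<and> v \<in> T}"
proof (rule card_le_two_card_image[where h = "\<lambda>(x, y). {v, x, y}"])
  show "finite {T. rainbow_triangle V E c T \<and> v \<in> T}"
    using assms(1)
    by (rule finite_subset[rotated, OF finite_Pow_iff[THEN iffD2]])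
       (auto simp: rainbow_triangle_def triangle_def)
  show "(\<lambda>(x, y). {v, x, y}) ` W \<subseteq> {T. rainbow_triangle V E c T \<and> v \<in> T}"
    using assms(3) by auto
  show "finite W" by fact
  fix a assume "a \<in> W"
  obtain x y where a: "a = (x, y)" by fastforce
  have "{b \<in> W. (case b of (x, y) \<Rightarrow> {v, x, y}) = (case a of (x, y) \<Rightarrow> {v, x, y})}
      \<subseteq> {a, (y, x)}"
  proof clarify
    fix p q
    assume pq: "(p, q) \<in> W" "(p, q) \<noteq> a" "{v, p, q} = (case a of (x, y) \<Rightarrow> {v, x, y})"
    have "v \<notin> {p, q}" "v \<notin> {x, y}"
      using assms(3) pq(1) \<open>a \<in> W\<close> a by auto
    moreover have "insert v {p, q} = insert v {x, y}"
      using pq(3) a by simp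
    ultimately have "{p, q} = {x, y}"
      by (metis insert_ident)
    then show "p = y \<and> q = x"
      using pq(2) a by (auto simp: doubleton_eq_iff)
  qed
  then show "\<exists>a'. {b \<in> W. (case b of (x, y) \<Rightarrow> {v, x, y}) = (case a of (x, y) \<Rightarrow> {v, x, y})}
      \<subseteq> {a, a'}" ..
qed

theorem theorem1p4:
  fixes V :: "'a set" and E :: "'a set set" and c :: "'a set \<Rightarrow> nat" and n k :: nat
  assumes "k \<ge> 1"
    and "complete_graph V E"
    and "card V = n"
    and "real (min_color_degree V E c) \<ge> (real n + real k) / 2"
  shows "\<forall>v\<in>V. card {T. rainbow_triangle V E c T \<and> v \<in> T} \<ge> k"
proof
  fix v assume v: "v \<in> V"
  have finV: "finite V"
    using assms(2) by (simp add: complete_graph_def simple_graph_def)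
  have degree: "n + k \<le> 2 * card ((\<lambda>y. c {x, y}) ` (V - {x}))" if x: "x \<in> V" for x
  proof -
    have "min_color_degree V E c \<le> color_degree E c x"
      using finV x by (simp add: min_color_degree_def)
    then have "real n + real k \<le> 2 * real (color_degree E c x)"
      using assms(4) by (simp add: field_simps)
    then have "n + k \<le> 2 * color_degree E c x"
      by linarith
    then show ?thesis
      using color_degree_complete_graph[OF assms(2) x] by metis
  qed
  define U where "U = V - {v}"
  define f where "f = (\<lambda>x. c {v, x})"
  define S where "S = {x \<in> U. \<forall>y\<in>U. f y = f x \<longrightarrow> y = x}"
  \<comment> \<open>The third inequality \<open>f x \<noteq> f y\<close> is omitted: it is automatic
    as soon as \<open>x\<close> or \<open>y\<close> lies in \<open>S\<close>.\<close>
  define rb where "rb = (\<lambda>x y. c {x, y} \<noteq> f x \<and> c {x, y} \<noteq> f y)"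
  have finU: "finite U" and finS: "finite S" and SU: "S \<subseteq> U"
    using finV by (auto simp: U_def S_def)
  have cardU: "card U + 1 = n"
    unfolding U_def using finV v assms(3) card_Suc_Diff1 by fastforce
  have inj: "y = x" if "x \<in> S" "y \<in> U" "f y = f x" for x y
    using that by (auto simp: S_def)
  \<comment> \<open>A vertex outside \<open>S\<close> shares its color with another vertex, which is
    then outside \<open>S\<close> too.\<close>
  have "2 * card (f ` (U - S)) \<le> card (U - S)"
    using finU by (intro card_image_two_fibres) (auto simp: S_def)
  moreover have "card (U - S) + card S = card U"
    using finU SU by (metis card_Diff_subset card_mono finS le_add_diff_inverse2)
  ultimately have repeated: "2 * card (f ` (U - S)) + card S + 1 \<le> n"
    using cardU by linarith
  have "card (f ` U) \<le> card (f ` S) + card (f ` (U - S))"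
    using SU by (metis Un_Diff_cancel2 card_Un_le image_Un sup.absorb1 sup_commute)
  moreover have "card (f ` S) \<le> card S"
    using finS by (rule card_image_le)
  moreover have "n + k \<le> 2 * card (f ` U)"
    using degree[OF v] by (simp add: f_def U_def)
  ultimately have cardS: "k + 1 \<le> card S"
    using repeated by linarith

  define P where "P x = {y \<in> U. x \<noteq> y \<and> (rb x y \<or> y \<in> S \<and> c {x, y} = f y)}" for x
  have finP: "finite (P x)" for x
    using finU by (simp add: P_def)
  have P: "card S + k \<le> 2 * card (P x) + 1" if x: "x \<in> S" for x
  proof -
    have xV: "x \<in> V" "x \<noteq> v"
      using x SU by (auto simp: U_def)
    \<comment> \<open>The vertex \<open>y = v\<close> gives \<open>f x\<close>. Any other
      \<open>y\<close> outside \<open>P x\<close> has \<open>c {x, y} = f x\<close>, or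
      \<open>c {x, y} = f y\<close> with \<open>y\<close> not in \<open>S\<close>, a repeated
      color.\<close>
    have "(\<lambda>y. c {x, y}) ` (V - {x}) \<subseteq> insert (f x) ((\<lambda>y. c {x, y}) ` P x \<union> f ` (U - S))"
      by (auto simp: P_def rb_def f_def U_def insert_commute)
    then have "card ((\<lambda>y. c {x, y}) ` (V - {x}))
        \<le> card (insert (f x) ((\<lambda>y. c {x, y}) ` P x \<union> f ` (U - S)))"
      using finP finU by (intro card_mono) auto
    also have "\<dots> \<le> 1 + card ((\<lambda>y. c {x, y}) ` P x \<union> f ` (U - S))"
      using finP finU by (simp add: card_insert_if)
    also have "\<dots> \<le> 1 + (card ((\<lambda>y. c {x, y}) ` P x) + card (f ` (U - S)))"
      by (intro add_left_mono card_Un_le)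
    also have "\<dots> \<le> 1 + (card (P x) + card (f ` (U - S)))"
      using finP by (intro add_left_mono add_right_mono card_image_le)
    finally show ?thesis
      using degree[OF xV(1)] repeated by linarith
  qed

  define A where "A = (SIGMA x:S. P x)"
  \<comment> \<open>Only one end has to be in \<open>S\<close>, since \<open>P x\<close> may leave
    \<open>S\<close>; this form makes \<open>W\<close> symmetric.\<close>
  define W where "W = {(x, y). x \<in> U \<and> y \<in> U \<and> (x \<in> S \<or> y \<in> S) \<and> x \<noteq> y \<and> rb x y}"
  define D where "D = {(x, y). x \<in> S \<and> y \<in> S \<and> x \<noteq> y}"
  have finW: "finite W"
    by (rule finite_subset[of _ "U \<times> U"]) (use finU in \<open>auto simp: W_def\<close>)
  have finD: "finite D"
    by (rule finite_subset[of _ "S \<times> S"]) (use finS in \<open>auto simp: D_def\<close>)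
  have rb_sym: "rb x y \<longleftrightarrow> rb y x" for x y
    by (auto simp: rb_def insert_commute)
  have "2 * card A \<le> card W + card D"
  proof (rule two_card_le_symmetrization[OF finW finD])
    show "A \<union> A\<inverse> \<subseteq> W \<union> D"
      using SU rb_sym by (auto simp: A_def W_def D_def P_def)
    show "A \<inter> A\<inverse> \<subseteq> W \<inter> D"
    proof clarify
      fix x y assume "(x, y) \<in> A" "(y, x) \<in> A"
      then have xy: "x \<in> S" "y \<in> S" "x \<noteq> y"
        and "rb x y \<or> c {x, y} = f y" "rb y x \<or> c {y, x} = f x"
        by (auto simp: A_def P_def)
      moreover have "f x \<noteq> f y"
        using inj xy SU by blast
      moreover have "c {y, x} = c {x, y}"
        by (simp add: insert_commute)
      \<comment> \<open>Otherwise the edge would have both the color \<open>f y\<close> and the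
        color \<open>f x\<close>.\<close>
      ultimately have "rb x y"
        using rb_sym by metis
      with xy SU show "(x, y) \<in> W \<inter> D"
        by (auto simp: W_def D_def)
    qed
  qed
  moreover have "card D = card S * (card S - 1)"
    unfolding D_def using finS by (rule card_off_diagonal)
  moreover have "card A = (\<Sum>x\<in>S. card (P x))"
    using finS finP by (simp add: A_def)
  moreover have "card S * (card S - 1 + k) \<le> 2 * (\<Sum>x\<in>S. card (P x))"
  proof -
    \<comment> \<open>The truncated subtraction is exact because \<open>S\<close> is nonempty by
      \<open>cardS\<close>.\<close>
    have "(\<Sum>x\<in>S. card S - 1 + k) \<le> (\<Sum>x\<in>S. 2 * card (P x))"
    proof (rule sum_mono)
      fix x assume "x \<in> S"
      from P[OF this] cardS show "card S - 1 + k \<le> 2 * card (P x)" by linarith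
    qed
    then show ?thesis by (simp add: sum_distrib_left)
  qed
  \<comment> \<open>The contribution \<open>card S * (card S - 1)\<close> of \<open>D\<close>
    cancels.\<close>
  ultimately have "card S * k \<le> card W"
    by (simp add: add_mult_distrib2)
  \<comment> \<open>Here \<open>k \<ge> 1\<close> enters: it gives \<open>card S \<ge> 2\<close>,
    which offsets the two orderings of each triangle.\<close>
  moreover have "2 * k \<le> card S * k"
    using cardS assms(1) by (intro mult_right_mono) auto
  moreover have "card W \<le> 2 * card {T. rainbow_triangle V E c T \<and> v \<in> T}"
  proof (rule card_rainbow_triangles_ge[OF finV finW])
    fix x y assume "(x, y) \<in> W"
    then have xy: "x \<in> U" "y \<in> U" "x \<noteq> y" "rb x y" "x \<in> S \<or> y \<in> S"
      by (auto simp: W_def)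
    then have "f x \<noteq> f y"
      using inj by metis
    with xy have "rainbow_triangle V E c {v, x, y}"
      by (intro rainbow_triangleI[OF assms(2) v]) (auto simp: U_def f_def rb_def)
    then show "x \<noteq> v \<and> y \<noteq> v \<and> rainbow_triangle V E c {v, x, y}"
      using xy by (auto simp: U_def)
  qed
  ultimately show "k \<le> card {T. rainbow_triangle V E c T \<and> v \<in> T}"
    by linarith
qed

end
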